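(* An algebra $\mathbf{D}=(D;\sqcap,\sqcup,\neg,\lrcorner,\top,\bot)$ of type $(2,2,1,1,0,0)$ is a double Boolean algebra if and only if it is a D-core algebra.
   Context: For an algebra $(D;\sqcap,\sqcup,\neg,\lrcorner,\top,\bot)$ of type $(2,2,1,1,0,0)$ write $x\vee y:=\neg(\neg x\sqcap\neg y)$ and $x\wedge y:=\lrcorner(\lrcorner x\sqcup\lrcorner y)$. A double Boolean algebra (dBa) is such an algebra satisfying, for all $x,y,z\in D$: $(x\sqcap x)\sqcap y=x\sqcap y$; $(x\sqcup x)\sqcup y=x\sqcup y$; $x\sqcap y=y\sqcap x$; $x\sqcup y=y\sqcup x$; $\neg(x\sqcap x)=\neg x$; $\lrcorner(x\sqcup x)=\lrcorner x$; $x\sqcap(x\sqcup y)=x\sqcap x$; $x\sqcup(x\sqcap y)=x\sqcup x$; $x\sqcap(y\vee z)=(x\sqcap y)\vee(x\sqcap z)$; $x\sqcup(y\wedge z)=(x\sqcup y)\wedge(x\sqcup z)$; $x\sqcap(x\vee y)=x\sqcap x$; $x\sqcup(x\wedge y)=x\sqcup x$; $\neg\neg(x\sqcap y)=x\sqcap y$; $\lrcorner\lrcorner(x\sqcup y)=x\sqcup y$; $x\sqcap\neg x=\bot$; $x\sqcup\lrcorner x=\top$; $\neg\top=\bot$; $\lrcorner\bot=\top$; $x\sqcap(y\sqcap z)=(x\sqcap y)\sqcap z$; $x\sqcup(y\sqcup z)=(x\sqcup y)\sqcup z$; $\neg\bot=\top\sqcap\top$; $\lrcorner\top=\bot\sqcup\bot$;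 $(x\sqcap x)\sqcup(x\sqcap x)=(x\sqcup x)\sqcap(x\sqcup x)$. A D-core algebra is such an algebra satisfying, for all $x,y,z\in D$: (1a) $x\sqcap y=y\sqcap x$, (1b) $x\sqcup y=y\sqcup x$; (2a) $\neg(x\sqcap x)=\neg x$, (2b) $\lrcorner(x\sqcup x)=\lrcorner x$; (3a) $x\sqcap(x\sqcup y)=x\sqcap x$, (3b) $x\sqcup(x\sqcap y)=x\sqcup x$; (4a) $x\sqcap(y\vee z)=(x\sqcap y)\vee(x\sqcap z)$, (4b) $x\sqcup(y\wedge z)=(x\sqcup y)\wedge(x\sqcup z)$; (5a) $\neg\neg(x\sqcap y)=x\sqcap y$, (5b) $\lrcorner\lrcorner(x\sqcup y)=x\sqcup y$; (6a) $x\sqcap\neg x=\bot$, (6b) $x\sqcup\lrcorner x=\top$; (7) $(x\sqcap x)\sqcup(x\sqcap x)=(x\sqcup x)\sqcap(x\sqcup x)$. *)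

theory Defs
  imports Main
begin

text \<open>
  The two negations are \<open>\<^bold>\<not>\<close> and \<open>\<sim>\<close>, the latter usually written as a lower right corner.  Bold \<open>\<^bold>\<or>\<close>
  and \<open>\<^bold>\<and>\<close> are operations on \<open>D\<close>, not connectives.  The laws are imposed on the carrier only; the
  operations are unconstrained outside \<open>D\<close>.
\<close>

locale double_algebra =
  fixes D :: "'a set"
    and meet :: "'a \<Rightarrow> 'a \<Rightarrow> 'a"  (infixl \<open>\<sqinter>\<close> 70)
    and join :: "'a \<Rightarrow> 'a \<Rightarrow> 'a"  (infixl \<open>\<squnion>\<close> 65)
    and neg :: "'a \<Rightarrow> 'a"  (\<open>\<^bold>\<not> _\<close> [81] 80)
    and opp :: "'a \<Rightarrow> 'a"  (\<open>\<sim> _\<close> [81] 80)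
    and top :: "'a"  (\<open>\<top>\<close>)
    and bot :: "'a"  (\<open>\<bottom>\<close>)
  assumes meet_closed: "\<lbrakk>x \<in> D; y \<in> D\<rbrakk> \<Longrightarrow> x \<sqinter> y \<in> D"
    and join_closed: "\<lbrakk>x \<in> D; y \<in> D\<rbrakk> \<Longrightarrow> x \<squnion> y \<in> D"
    and neg_closed: "x \<in> D \<Longrightarrow> \<^bold>\<not> x \<in> D"
    and opp_closed: "x \<in> D \<Longrightarrow> \<sim> x \<in> D"
    and top_closed: "\<top> \<in> D"
    and bot_closed: "\<bottom> \<in> D"
begin

definition vee :: "'a \<Rightarrow> 'a \<Rightarrow> 'a"  (infixl \<open>\<^bold>\<or>\<close> 65)
  where "x \<^bold>\<or> y = \<^bold>\<not> (\<^bold>\<not> x \<sqinter> \<^bold>\<not> y)"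

definition wedge :: "'a \<Rightarrow> 'a \<Rightarrow> 'a"  (infixl \<open>\<^bold>\<and>\<close> 70)
  where "x \<^bold>\<and> y = \<sim> (\<sim> x \<squnion> \<sim> y)"

end

locale double_Boolean_algebra = double_algebra +
  assumes meet_idem_left: "\<lbrakk>x \<in> D; y \<in> D\<rbrakk> \<Longrightarrow> (x \<sqinter> x) \<sqinter> y = x \<sqinter> y"
    and join_idem_left: "\<lbrakk>x \<in> D; y \<in> D\<rbrakk> \<Longrightarrow> (x \<squnion> x) \<squnion> y = x \<squnion> y"
    and meet_commute: "\<lbrakk>x \<in> D; y \<in> D\<rbrakk> \<Longrightarrow> x \<sqinter> y = y \<sqinter> x"
    and join_commute: "\<lbrakk>x \<in> D; y \<in> D\<rbrakk> \<Longrightarrow> x \<squnion> y = y \<squnion> x"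
    and neg_meet_idem: "x \<in> D \<Longrightarrow> \<^bold>\<not> (x \<sqinter> x) = \<^bold>\<not> x"
    and opp_join_idem: "x \<in> D \<Longrightarrow> \<sim> (x \<squnion> x) = \<sim> x"
    and meet_join_absorb: "\<lbrakk>x \<in> D; y \<in> D\<rbrakk> \<Longrightarrow> x \<sqinter> (x \<squnion> y) = x \<sqinter> x"
    and join_meet_absorb: "\<lbrakk>x \<in> D; y \<in> D\<rbrakk> \<Longrightarrow> x \<squnion> (x \<sqinter> y) = x \<squnion> x"
    and meet_vee_distrib:
      "\<lbrakk>x \<in> D; y \<in> D; z \<in> D\<rbrakk> \<Longrightarrow> x \<sqinter> (y \<^bold>\<or> z) = (x \<sqinter> y) \<^bold>\<or> (x \<sqinter> z)"
    and join_wedge_distrib: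
      "\<lbrakk>x \<in> D; y \<in> D; z \<in> D\<rbrakk> \<Longrightarrow> x \<squnion> (y \<^bold>\<and> z) = (x \<squnion> y) \<^bold>\<and> (x \<squnion> z)"
    and meet_vee_absorb: "\<lbrakk>x \<in> D; y \<in> D\<rbrakk> \<Longrightarrow> x \<sqinter> (x \<^bold>\<or> y) = x \<sqinter> x"
    and join_wedge_absorb: "\<lbrakk>x \<in> D; y \<in> D\<rbrakk> \<Longrightarrow> x \<squnion> (x \<^bold>\<and> y) = x \<squnion> x"
    and neg_neg_meet: "\<lbrakk>x \<in> D; y \<in> D\<rbrakk> \<Longrightarrow> \<^bold>\<not> (\<^bold>\<not> (x \<sqinter> y)) = x \<sqinter> y"
    and opp_opp_join: "\<lbrakk>x \<in> D; y \<in> D\<rbrakk> \<Longrightarrow> \<sim> (\<sim> (x \<squnion> y)) = x \<squnion> y"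
    and meet_neg: "x \<in> D \<Longrightarrow> x \<sqinter> \<^bold>\<not> x = \<bottom>"
    and join_opp: "x \<in> D \<Longrightarrow> x \<squnion> \<sim> x = \<top>"
    and neg_top: "\<^bold>\<not> \<top> = \<bottom>"
    and opp_bot: "\<sim> \<bottom> = \<top>"
    and meet_assoc: "\<lbrakk>x \<in> D; y \<in> D; z \<in> D\<rbrakk> \<Longrightarrow> x \<sqinter> (y \<sqinter> z) = (x \<sqinter> y) \<sqinter> z"
    and join_assoc: "\<lbrakk>x \<in> D; y \<in> D; z \<in> D\<rbrakk> \<Longrightarrow> x \<squnion> (y \<squnion> z) = (x \<squnion> y) \<squnion> z"
    and neg_bot: "\<^bold>\<not> \<bottom> = \<top> \<sqinter> \<top>"
    and opp_top: "\<sim> \<top> = \<bottom> \<squnion> \<bottom>"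
    and double_idem: "x \<in> D \<Longrightarrow> (x \<sqinter> x) \<squnion> (x \<sqinter> x) = (x \<squnion> x) \<sqinter> (x \<squnion> x)"

locale D_core_algebra = double_algebra +
  assumes meet_commute: "\<lbrakk>x \<in> D; y \<in> D\<rbrakk> \<Longrightarrow> x \<sqinter> y = y \<sqinter> x"
    and join_commute: "\<lbrakk>x \<in> D; y \<in> D\<rbrakk> \<Longrightarrow> x \<squnion> y = y \<squnion> x"
    and neg_meet_idem: "x \<in> D \<Longrightarrow> \<^bold>\<not> (x \<sqinter> x) = \<^bold>\<not> x"
    and opp_join_idem: "x \<in> D \<Longrightarrow> \<sim> (x \<squnion> x) = \<sim> x"
    and meet_join_absorb: "\<lbrakk>x \<in> D; y \<in> D\<rbrakk> \<Longrightarrow> x \<sqinter> (x \<squnion> y) = x \<sqinter> x"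
    and join_meet_absorb: "\<lbrakk>x \<in> D; y \<in> D\<rbrakk> \<Longrightarrow> x \<squnion> (x \<sqinter> y) = x \<squnion> x"
    and meet_vee_distrib:
      "\<lbrakk>x \<in> D; y \<in> D; z \<in> D\<rbrakk> \<Longrightarrow> x \<sqinter> (y \<^bold>\<or> z) = (x \<sqinter> y) \<^bold>\<or> (x \<sqinter> z)"
    and join_wedge_distrib:
      "\<lbrakk>x \<in> D; y \<in> D; z \<in> D\<rbrakk> \<Longrightarrow> x \<squnion> (y \<^bold>\<and> z) = (x \<squnion> y) \<^bold>\<and> (x \<squnion> z)"
    and neg_neg_meet: "\<lbrakk>x \<in> D; y \<in> D\<rbrakk> \<Longrightarrow> \<^bold>\<not> (\<^bold>\<not> (x \<sqinter> y)) = x \<sqinter> y"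
    and opp_opp_join: "\<lbrakk>x \<in> D; y \<in> D\<rbrakk> \<Longrightarrow> \<sim> (\<sim> (x \<squnion> y)) = x \<squnion> y"
    and meet_neg: "x \<in> D \<Longrightarrow> x \<sqinter> \<^bold>\<not> x = \<bottom>"
    and join_opp: "x \<in> D \<Longrightarrow> x \<squnion> \<sim> x = \<top>"
    and double_idem: "x \<in> D \<Longrightarrow> (x \<sqinter> x) \<squnion> (x \<sqinter> x) = (x \<squnion> x) \<sqinter> (x \<squnion> x)"

end

theory Submission
  imports Defs
begin

text \<open>
  In a D-core algebra each of the two sorts of operations, \<open>\<sqinter>, \<^bold>\<not>\<close> and \<open>\<squnion>, \<sim>\<close>, can be treated on its own
  once absorption has produced the law \<open>x \<sqinter> \<top> = x \<sqinter> x\<close> and its dual. The law \<open>x \<sqinter> (y \<sqinter> y) = x \<sqinter> y\<close> follows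
  from distributivity because \<open>y \<^bold>\<or> y = y \<sqinter> y\<close>, and it reduces everything to the idempotents
  \<open>x = x \<sqinter> x\<close>. There \<open>\<^bold>\<not>\<close> is an involution, so De Morgan duality yields the second distributive law,
  and the idempotents satisfy Huntington's axioms for Boolean algebras, which imply
  absorption and associativity.
\<close>

locale huntington_algebra =
  fixes B :: "'a set"
    and conj :: "'a \<Rightarrow> 'a \<Rightarrow> 'a"  (infixl \<open>\<sqinter>\<close> 70)
    and disj :: "'a \<Rightarrow> 'a \<Rightarrow> 'a"  (infixl \<open>\<squnion>\<close> 65)
    and compl :: "'a \<Rightarrow> 'a"  (\<open>\<^bold>\<not> _\<close> [81] 80)
    and one :: "'a"  (\<open>\<one>\<close>)
    and zero :: "'a"  (\<open>\<zero>\<close>)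
  assumes conj_closed [simp]: "\<lbrakk>x \<in> B; y \<in> B\<rbrakk> \<Longrightarrow> x \<sqinter> y \<in> B"
    and disj_closed [simp]: "\<lbrakk>x \<in> B; y \<in> B\<rbrakk> \<Longrightarrow> x \<squnion> y \<in> B"
    and compl_closed [simp]: "x \<in> B \<Longrightarrow> \<^bold>\<not> x \<in> B"
    and one_closed [simp]: "\<one> \<in> B"
    and zero_closed [simp]: "\<zero> \<in> B"
    and conj_commute: "\<lbrakk>x \<in> B; y \<in> B\<rbrakk> \<Longrightarrow> x \<sqinter> y = y \<sqinter> x"
    and disj_commute: "\<lbrakk>x \<in> B; y \<in> B\<rbrakk> \<Longrightarrow> x \<squnion> y = y \<squnion> x"
    and conj_disj_distrib:
      "\<lbrakk>x \<in> B; y \<in> B; z \<in> B\<rbrakk> \<Longrightarrow> x \<sqinter> (y \<squnion> z) = (x \<sqinter> y) \<squnion> (x \<sqinter> z)"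
    and disj_conj_distrib:
      "\<lbrakk>x \<in> B; y \<in> B; z \<in> B\<rbrakk> \<Longrightarrow> x \<squnion> (y \<sqinter> z) = (x \<squnion> y) \<sqinter> (x \<squnion> z)"
    and conj_one: "x \<in> B \<Longrightarrow> x \<sqinter> \<one> = x"
    and disj_zero: "x \<in> B \<Longrightarrow> x \<squnion> \<zero> = x"
    and conj_compl: "x \<in> B \<Longrightarrow> x \<sqinter> \<^bold>\<not> x = \<zero>"
    and disj_compl: "x \<in> B \<Longrightarrow> x \<squnion> \<^bold>\<not> x = \<one>"
begin

text \<open>The axioms are symmetric under exchanging the two operations together with the two
  constants, so every lemma of the locale also holds in its dual form.\<close>

lemma dual: "huntington_algebra B disj conj compl zero one"
  by unfold_locales
    (fact disj_closed conj_closed compl_closed zero_closed one_closed disj_commute conj_commute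
      disj_conj_distrib conj_disj_distrib disj_zero conj_one disj_compl conj_compl)+

lemma conj_zero:
  assumes x: "x \<in> B"
  shows "x \<sqinter> \<zero> = \<zero>"
proof -
  have "x \<sqinter> \<zero> = (x \<sqinter> \<^bold>\<not> x) \<squnion> (x \<sqinter> \<zero>)"
    using x by (simp add: conj_compl disj_commute[of \<zero>] disj_zero)
  also have "\<dots> = x \<sqinter> (\<^bold>\<not> x \<squnion> \<zero>)"
    using x by (simp add: conj_disj_distrib)
  also have "\<dots> = \<zero>"
    using x by (simp add: disj_zero conj_compl)
  finally show ?thesis .
qed

lemma conj_disj_absorb:
  assumes "x \<in> B" "y \<in> B"
  shows "x \<sqinter> (x \<squnion> y) = x"
proof -
  have "x \<sqinter> (x \<squnion> y) = (x \<squnion> \<zero>) \<sqinter> (x \<squnion> y)"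
    using assms by (simp add: disj_zero)
  also have "\<dots> = x \<squnion> (y \<sqinter> \<zero>)"
    using assms by (simp add: disj_conj_distrib[symmetric] conj_commute[of \<zero>])
  also have "\<dots> = x"
    using assms by (simp add: conj_zero disj_zero)
  finally show ?thesis .
qed

lemma disj_conj_absorb: "\<lbrakk>x \<in> B; y \<in> B\<rbrakk> \<Longrightarrow> x \<squnion> (x \<sqinter> y) = x"
  by (rule huntington_algebra.conj_disj_absorb[OF dual])

text \<open>A substitute for case analysis on \<open>x\<close>: since \<open>x\<close> and its
  complement meet in \<open>zero\<close>, distributivity recovers any \<open>c\<close> from its
  disjunctions with both. It does not presuppose associativity.\<close>

lemma eq_by_disj:
  assumes B: "x \<in> B" "a \<in> B" "b \<in> B"
    and eq: "x \<squnion> a = x \<squnion> b" "\<^bold>\<not> x \<squnion> a = \<^bold>\<not> x \<squnion> b"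
  shows "a = b"
proof -
  have "c = (x \<squnion> c) \<sqinter> (\<^bold>\<not> x \<squnion> c)" if "c \<in> B" for c
  proof -
    have "(x \<squnion> c) \<sqinter> (\<^bold>\<not> x \<squnion> c) = c \<squnion> (x \<sqinter> \<^bold>\<not> x)"
      using B that by (simp add: disj_conj_distrib disj_commute[of c])
    then show ?thesis
      using B that by (simp add: conj_compl disj_zero)
  qed
  then show ?thesis
    using B eq by metis
qed

text \<open>Disjoined with \<open>x\<close>, both sides collapse to \<open>x\<close> by absorption.
  Disjoined with the complement of \<open>x\<close>, the factor \<open>x\<close> drops out and both
  sides become the conjunction of the disjunctions with \<open>y\<close> and with
  \<open>z\<close>.\<close>

lemma conj_assoc:
  assumes B: "x \<in> B" "y \<in> B" "z \<in> B"
  shows "x \<sqinter> (y \<sqinter> z) = (x \<sqinter> y) \<sqinter> z"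
proof (rule eq_by_disj[of x])
  show "x \<squnion> x \<sqinter> (y \<sqinter> z) = x \<squnion> x \<sqinter> y \<sqinter> z"
    using B by (simp add: disj_conj_absorb disj_conj_distrib[of x "x \<sqinter> y"] conj_disj_absorb)
  have *: "\<^bold>\<not> x \<squnion> (x \<sqinter> w) = \<^bold>\<not> x \<squnion> w" if "w \<in> B" for w
    using B that
    by (simp add: disj_conj_distrib disj_commute[of "\<^bold>\<not> x" x] disj_compl
        conj_commute[of \<one>] conj_one)
  show "\<^bold>\<not> x \<squnion> x \<sqinter> (y \<sqinter> z) = \<^bold>\<not> x \<squnion> x \<sqinter> y \<sqinter> z"
    using B by (simp add: * disj_conj_distrib[of "\<^bold>\<not> x" "x \<sqinter> y"] disj_conj_distrib[of "\<^bold>\<not> x" y])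
qed (use B in simp_all)

end

text \<open>One sort of operations in isolation, to be instantiated once for \<open>meet\<close> and
  \<open>neg\<close> and once for \<open>join\<close> and \<open>opp\<close>. The law
  \<open>meet_top\<close> is all that is kept of the interaction with the other sort.\<close>

locale D_core_half =
  fixes D :: "'a set"
    and meet :: "'a \<Rightarrow> 'a \<Rightarrow> 'a"  (infixl \<open>\<sqinter>\<close> 70)
    and neg :: "'a \<Rightarrow> 'a"  (\<open>\<^bold>\<not> _\<close> [81] 80)
    and top :: "'a"  (\<open>\<top>\<close>)
    and bot :: "'a"  (\<open>\<bottom>\<close>)
  assumes meet_closed [simp]: "\<lbrakk>x \<in> D; y \<in> D\<rbrakk> \<Longrightarrow> x \<sqinter> y \<in> D"
    and neg_closed [simp]: "x \<in> D \<Longrightarrow> \<^bold>\<not> x \<in> D"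
    and top_closed [simp]: "\<top> \<in> D"
    and bot_closed [simp]: "\<bottom> \<in> D"
    and meet_commute: "\<lbrakk>x \<in> D; y \<in> D\<rbrakk> \<Longrightarrow> x \<sqinter> y = y \<sqinter> x"
    and neg_meet_idem: "x \<in> D \<Longrightarrow> \<^bold>\<not> (x \<sqinter> x) = \<^bold>\<not> x"
    and meet_vee_distrib:
      "\<lbrakk>x \<in> D; y \<in> D; z \<in> D\<rbrakk>
        \<Longrightarrow> x \<sqinter> \<^bold>\<not> (\<^bold>\<not> y \<sqinter> \<^bold>\<not> z) = \<^bold>\<not> (\<^bold>\<not> (x \<sqinter> y) \<sqinter> \<^bold>\<not> (x \<sqinter> z))"
    and neg_neg_meet: "\<lbrakk>x \<in> D; y \<in> D\<rbrakk> \<Longrightarrow> \<^bold>\<not> (\<^bold>\<not> (x \<sqinter> y)) = x \<sqinter> y"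
    and meet_neg: "x \<in> D \<Longrightarrow> x \<sqinter> \<^bold>\<not> x = \<bottom>"
    and meet_top: "x \<in> D \<Longrightarrow> x \<sqinter> \<top> = x \<sqinter> x"
begin

text \<open>By \<open>neg_neg\<close> these are exactly the elements of \<open>D\<close> fixed by
  double negation; all values of \<open>meet\<close> and \<open>neg\<close> on \<open>D\<close> lie
  among them.\<close>

definition idems :: "'a set"
  where "idems = {x \<in> D. x \<sqinter> x = x}"

lemma neg_neg: "x \<in> D \<Longrightarrow> \<^bold>\<not> (\<^bold>\<not> x) = x \<sqinter> x"
  using neg_neg_meet[of x x] by (simp add: neg_meet_idem)

lemma neg_idem: "x \<in> D \<Longrightarrow> \<^bold>\<not> x \<sqinter> \<^bold>\<not> x = \<^bold>\<not> x"
  using neg_neg[of "\<^bold>\<not> x"] by (simp add: neg_neg neg_meet_idem)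

lemma meet_idem: "\<lbrakk>x \<in> D; y \<in> D\<rbrakk> \<Longrightarrow> (x \<sqinter> y) \<sqinter> (x \<sqinter> y) = x \<sqinter> y"
  using neg_neg[of "x \<sqinter> y"] by (simp add: neg_neg_meet)

lemma meet_idem_right: "\<lbrakk>x \<in> D; y \<in> D\<rbrakk> \<Longrightarrow> x \<sqinter> (y \<sqinter> y) = x \<sqinter> y"
  using meet_vee_distrib[of x y y] by (simp add: neg_idem neg_neg meet_idem)

lemma meet_idem_left: "\<lbrakk>x \<in> D; y \<in> D\<rbrakk> \<Longrightarrow> (x \<sqinter> x) \<sqinter> y = x \<sqinter> y"
  using meet_idem_right[of y x] by (simp add: meet_commute)

text \<open>The meet of \<top> with its negation is evaluated twice: \<open>meet_neg\<close> gives
  \<bottom>, while \<open>meet_top\<close> gives the square of \<open>neg\<close> \<top>, which is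
  \<open>neg\<close> \<top> itself.\<close>

lemma neg_top: "\<^bold>\<not> \<top> = \<bottom>"
  using meet_neg[of \<top>] meet_top[of "\<^bold>\<not> \<top>"] by (simp add: meet_commute neg_idem)

lemma neg_bot: "\<^bold>\<not> \<bottom> = \<top> \<sqinter> \<top>"
  using neg_neg[of \<top>] by (simp add: neg_top)

text \<open>This is \<open>meet_vee_distrib\<close> at the negated arguments, with both sides
  negated; double negations cancel on idempotents and on meets.\<close>

lemma vee_meet_distrib:
  assumes "x \<in> idems" "y \<in> idems" "z \<in> idems"
  shows "\<^bold>\<not> (\<^bold>\<not> x \<sqinter> \<^bold>\<not> (y \<sqinter> z)) = \<^bold>\<not> (\<^bold>\<not> x \<sqinter> \<^bold>\<not> y) \<sqinter> \<^bold>\<not> (\<^bold>\<not> x \<sqinter> \<^bold>\<not> z)"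
  using meet_vee_distrib[of "\<^bold>\<not> x" "\<^bold>\<not> y" "\<^bold>\<not> z"] assms
  by (simp add: idems_def neg_neg meet_idem)

text \<open>The unit is \<open>neg\<close> \<bottom>, the square of \<top>, because \<top> itself
  may fail to be idempotent.\<close>

lemma huntington_idems:
  "huntington_algebra idems meet (\<lambda>x y. \<^bold>\<not> (\<^bold>\<not> x \<sqinter> \<^bold>\<not> y)) neg (\<^bold>\<not> \<bottom>) \<bottom>"
proof
  show "\<^bold>\<not> (\<^bold>\<not> x \<sqinter> \<^bold>\<not> (y \<sqinter> z)) = \<^bold>\<not> (\<^bold>\<not> x \<sqinter> \<^bold>\<not> y) \<sqinter> \<^bold>\<not> (\<^bold>\<not> x \<sqinter> \<^bold>\<not> z)"
    if "x \<in> idems" "y \<in> idems" "z \<in> idems" for x y z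
    using that by (rule vee_meet_distrib)
  have one: "x \<sqinter> \<^bold>\<not> \<bottom> = x" if "x \<in> idems" for x
    using that by (simp add: idems_def neg_bot meet_idem_right meet_top[of x])
  show "x \<sqinter> \<^bold>\<not> \<bottom> = x" if "x \<in> idems" for x
    using that by (rule one)
  show "\<^bold>\<not> (\<^bold>\<not> x \<sqinter> \<^bold>\<not> \<bottom>) = x" if "x \<in> idems" for x
    using that one[of "\<^bold>\<not> x"] by (simp add: idems_def neg_idem neg_neg)
  show "\<^bold>\<not> (\<^bold>\<not> x \<sqinter> \<^bold>\<not> (\<^bold>\<not> x)) = \<^bold>\<not> \<bottom>" if "x \<in> idems" for x
    using that by (simp add: idems_def meet_neg)
  \<comment> \<open>As the negation of \<top>, the element \<bottom> is idempotent.\<close>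
  show "\<bottom> \<in> idems"
    using neg_idem[of \<top>] by (simp add: idems_def neg_top)
  show "x \<sqinter> \<^bold>\<not> (\<^bold>\<not> y \<sqinter> \<^bold>\<not> z) = \<^bold>\<not> (\<^bold>\<not> (x \<sqinter> y) \<sqinter> \<^bold>\<not> (x \<sqinter> z))"
    if "x \<in> idems" "y \<in> idems" "z \<in> idems" for x y z
    using that by (intro meet_vee_distrib) (simp_all add: idems_def)
qed (auto simp: idems_def meet_idem neg_idem meet_neg meet_commute)

lemma square_in_idems: "x \<in> D \<Longrightarrow> x \<sqinter> x \<in> idems"
  by (simp add: idems_def meet_idem)

lemma meet_assoc:
  assumes D: "x \<in> D" "y \<in> D" "z \<in> D"
  shows "x \<sqinter> (y \<sqinter> z) = (x \<sqinter> y) \<sqinter> z"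
  \<comment> \<open>Associativity holds for the squares of \<open>x\<close>, \<open>y\<close> and
    \<open>z\<close>, and a square may be replaced by its root inside any meet with another
    element.\<close>
  using huntington_algebra.conj_assoc[OF huntington_idems D[THEN square_in_idems]] D
  by (simp add: meet_idem_left meet_idem_right)

lemma meet_vee_absorb:
  assumes D: "x \<in> D" "y \<in> D"
  shows "x \<sqinter> \<^bold>\<not> (\<^bold>\<not> x \<sqinter> \<^bold>\<not> y) = x \<sqinter> x"
  using huntington_algebra.conj_disj_absorb[OF huntington_idems D[THEN square_in_idems]] D
  by (simp add: meet_idem_left neg_meet_idem)

end

context D_core_algebra
begin

lemma meet_half: "D_core_half D meet neg \<top> \<bottom>"
proof
  show "x \<sqinter> \<top> = x \<sqinter> x" if "x \<in> D" for x
    \<comment> \<open>The element \<open>opp x\<close> is chosen because its join with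
      \<open>x\<close> is \<top>, which turns absorption into the required law.\<close>
    using meet_join_absorb[of x "\<sim> x"] that by (simp add: join_opp opp_closed)
qed (use meet_vee_distrib in \<open>simp_all add: vee_def meet_closed neg_closed top_closed bot_closed
      meet_commute neg_meet_idem neg_neg_meet meet_neg\<close>)

text \<open>The constants trade places: \<open>x\<close> joined with \<open>opp x\<close> is \<top>,
  so \<top> takes the role that \<bottom> has for \<open>meet\<close>.\<close>

lemma join_half: "D_core_half D join opp \<bottom> \<top>"
proof
  show "x \<squnion> \<bottom> = x \<squnion> x" if "x \<in> D" for x
    using join_meet_absorb[of x "\<^bold>\<not> x"] that by (simp add: meet_neg neg_closed)
qed (use join_wedge_distrib in \<open>simp_all add: wedge_def join_closed opp_closed top_closed bot_closed
      join_commute opp_join_idem opp_opp_join join_opp\<close>)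

lemma double_Boolean: "double_Boolean_algebra D meet join neg opp \<top> \<bottom>"
proof -
  interpret m: D_core_half D meet neg \<top> \<bottom> by (rule meet_half)
  interpret j: D_core_half D join opp \<bottom> \<top> by (rule join_half)
  show ?thesis
    by unfold_locales
      (fact m.meet_idem_left j.meet_idem_left meet_commute join_commute neg_meet_idem
        opp_join_idem meet_join_absorb join_meet_absorb meet_vee_distrib join_wedge_distrib
        m.meet_vee_absorb[folded vee_def] j.meet_vee_absorb[folded wedge_def]
        neg_neg_meet opp_opp_join meet_neg join_opp m.neg_top j.neg_top m.meet_assoc j.meet_assoc
        m.neg_bot j.neg_bot double_idem)+
qed

end

lemma (in double_Boolean_algebra) D_core: "D_core_algebra D meet join neg opp \<top> \<bottom>"
  by unfold_locales
    (fact meet_commute join_commute neg_meet_idem opp_join_idem meet_join_absorb join_meet_absorb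
      meet_vee_distrib join_wedge_distrib neg_neg_meet opp_opp_join meet_neg join_opp double_idem)+

theorem theorem3p13:
  fixes D :: "'a set"
    and meet join :: "'a \<Rightarrow> 'a \<Rightarrow> 'a"
    and neg opp :: "'a \<Rightarrow> 'a"
    and top bot :: "'a"
  assumes "double_algebra D meet join neg opp top bot"
  shows "double_Boolean_algebra D meet join neg opp top bot
    \<longleftrightarrow> D_core_algebra D meet join neg opp top bot"
  by (rule iffI) (erule double_Boolean_algebra.D_core, erule D_core_algebra.double_Boolean)

end
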